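(* There exist an absolute constant $C>0$ and a function $\delta:\mathbb{N}\to[0,\infty)$ with $\delta(n)\to0$ as $n\to\infty$ such that the following holds. Let $n\ge4$ be even, let $k$ be a positive integer, let $\gamma>0$, let $v_0\in V(C_{n,k})$, and let $f$ be chosen uniformly at random from $\mathrm{Lip}_{v_0}(C_{n,k};\infty)$. If $k\le \frac{\log n}{\gamma}$, then $$\mathbb{P}\left[R(f)<C\gamma\right]\le\delta(n).$$
   Context: $\log$ denotes $\log_2$. For $n,k\in\mathbb{N}$ with $n$ even, $C_{n,k}$ is the graph with vertex set $[n]\times[k]$ in which $(u,u')$ and $(w,w')$ are adjacent iff $u-w\equiv\pm1\pmod n$ (a cycle of $n$ layers of $k$ vertices each, with complete bipartite graphs between cyclically consecutive layers and no edges inside layers). For a connected finite graph $G$ and $v_0\in V(G)$, $\mathrm{Lip}_{v_0}(G;\infty)$ is the set of functions $f:V(G)\to\mathbb{R}$ such that $f(v_0)=0$ and $|f(u)-f(v)|\le1$ for all $\{u,v\}\in E(G)$. It is identified with a compact subset of $\mathbb{R}^{V(G)\setminus\{v_0\}}$ of positive finite Lebesgue measure, and "uniformly at random" means with respect to normalized Lebesgue measure on this set. The range of $f$ is $R(f):=\max_{v\in V(G)}f(v)-\min_{v\in V(G)}f(v)+1$. *)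

theory Defs
  imports "HOL-Probability.Probability" "HOL-Number_Theory.Cong"
begin

text \<open>A finite graph is given by its vertex set \<open>V\<close> and its set \<open>E\<close> of edges, which are
  unordered pairs of vertices.\<close>

definition cyc_verts :: "nat \<Rightarrow> nat \<Rightarrow> (nat \<times> nat) set" where
  "cyc_verts n k = {1..n} \<times> {1..k}"

definition cyc_edges :: "nat \<Rightarrow> nat \<Rightarrow> (nat \<times> nat) set set" where
  "cyc_edges n k = {{(u, u'), (w, w')} | u u' w w'.
     (u, u') \<in> cyc_verts n k \<and> (w, w') \<in> cyc_verts n k \<and>
     ([int u - int w = 1] (mod int n) \<or> [int u - int w = - 1] (mod int n))}"

text \<open>Functions on \<open>V\<close> are represented by functions that are \<^const>\<open>undefined\<close> outside \<open>V\<close>.\<close>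

definition Lip :: "'a set \<Rightarrow> 'a set set \<Rightarrow> 'a \<Rightarrow> ('a \<Rightarrow> real) set" where
  "Lip V E v0 = {f \<in> V \<rightarrow>\<^sub>E UNIV. f v0 = 0 \<and> (\<forall>u v. {u, v} \<in> E \<longrightarrow> \<bar>f u - f v\<bar> \<le> 1)}"

text \<open>Normalized Lebesgue measure on \<^const>\<open>Lip\<close>: a vector \<open>g\<close> indexed by \<open>V - {v0}\<close> is
  identified with the function on \<open>V\<close> that extends it by the value 0 at \<open>v0\<close>.\<close>

definition Lip_unif :: "'a set \<Rightarrow> 'a set set \<Rightarrow> 'a \<Rightarrow> ('a \<Rightarrow> real) measure" where
  "Lip_unif V E v0 =
     (let L = (\<Pi>\<^sub>M v\<in>V - {v0}. lborel) in
      distr (uniform_measure L {g \<in> space L. g(v0 := 0) \<in> Lip V E v0})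
            (\<Pi>\<^sub>M v\<in>V. borel) (\<lambda>g. g(v0 := 0)))"

definition Lip_range :: "'a set \<Rightarrow> ('a \<Rightarrow> real) \<Rightarrow> real" where
  "Lip_range V f = Max (f ` V) - Min (f ` V) + 1"

end

theory Submission
  imports Defs "HOL-Real_Asymp.Real_Asymp"
begin

text \<open>The range is large because a function that is flat on the whole cycle can be pulled up into a
  high peak inside any one of many disjoint blocks of layers, at a cost in volume that is smaller
  than the number of blocks.

  Let \<open>D\<close> be an integer of order \<open>\<gamma>\<close>, and let \<open>B\<close> be the block of the \<open>2 * D - 1\<close> layers strictly
  between the layers \<open>a\<close> and \<open>a + 2 * D\<close>. Given a Lipschitz function \<open>f\<close> all of whose values
  lie within \<open>3 / 4 * D\<close> of each other, replace \<open>f\<close> on \<open>B\<close> by \<open>3 / 4 * Z + 1 / 4 * f\<close>, where the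
  tent \<open>Z\<close> is the largest Lipschitz extension of \<open>f\<close> from the two layers that bound \<open>B\<close>. The
  result is a convex combination of two Lipschitz functions on the whole cycle, namely \<open>f\<close> and
  \<open>f\<close> with \<open>Z\<close> glued in on \<open>B\<close>, and so it is Lipschitz (\<open>pull_up_Lip\<close>).
  As \<open>Z\<close> climbs by \<open>D\<close> up to the middle of the block, the result exceeds, somewhere in \<open>B\<close>, all
  its values off \<open>B\<close> (\<open>pull_up_peak\<close>). The tent depends only on the values of \<open>f\<close>
  off \<open>B\<close>, so for fixed outer values the modification is a homothety of ratio \<open>1 / 4\<close> in
  \<open>card B = k * (2 * D - 1)\<close> coordinates. Hence the set of flat functions has at most
  \<open>4 ^ (k * (2 * D - 1))\<close> times the volume of the set of functions with their peak in \<open>B\<close>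
  (\<open>emeasure_PiM_lborel_le_by_shrinking\<close>, \<open>emeasure_flat_le_peaked\<close>).

  For disjoint blocks the sets of functions that have their peak there are disjoint. About
  \<open>n / (2 * D)\<close> disjoint blocks fit into the cycle, and at most one of them contains the vertex
  at which functions are pinned to 0; so the probability of being flat is at most about
  \<open>4 ^ (k * (2 * D - 1)) * 2 * D / n\<close> (\<open>prob_flat_le\<close>). Since \<open>k * \<gamma> \<le> log 2 n\<close>, a small
  constant in the relation between \<open>D\<close> and \<open>\<gamma>\<close> makes the exponential factor at most
  \<open>sqrt n\<close>, and the bound tends to 0 uniformly in \<open>k\<close>.\<close>

section \<open>Homotheties in some coordinates of a product of Lebesgue measures\<close>

lemma nn_integral_PiM_lborel_affine:
  fixes h :: "('i \<Rightarrow> real) \<Rightarrow> ennreal" and t :: "'i \<Rightarrow> real"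
  assumes "finite B" "c > 0" "h \<in> borel_measurable (\<Pi>\<^sub>M i\<in>B. lborel)"
  shows "(\<integral>\<^sup>+y. h y \<partial>(\<Pi>\<^sub>M i\<in>B. lborel)) =
    ennreal (c ^ card B) * (\<integral>\<^sup>+y. h (\<lambda>i\<in>B. t i + c * y i) \<partial>(\<Pi>\<^sub>M i\<in>B. lborel))"
  using assms(1,3)
proof (induction B arbitrary: h)
  case empty
  interpret product_sigma_finite "\<lambda>_::'i. lborel :: real measure" ..
  show ?case by (simp add: PiM_empty nn_integral_count_space_finite)
next
  case (insert b B)
  interpret product_sigma_finite "\<lambda>_::'i. lborel :: real measure" ..
  let ?M = "\<lambda>B. \<Pi>\<^sub>M i\<in>B. (lborel :: real measure)"
  let ?T = "\<lambda>B y. \<lambda>i\<in>B. t i + c * y i"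
  note [measurable] = insert.prems
  have meas_add: "(\<lambda>x. h (x(b := y))) \<in> borel_measurable (?M B)" for y
    by (rule measurable_compose[OF measurable_fun_upd[where J = B] insert.prems]) auto
  have T: "(?T B) \<in> measurable (?M B) (?M B)"
    by measurable
  have T': "(?T (insert b B)) \<in> measurable (?M (insert b B)) (?M (insert b B))"
    by measurable
  have pow: "ennreal (c ^ card (insert b B)) * X = ennreal (c ^ card B) * (ennreal c * X)" for X
    using insert.hyps \<open>c > 0\<close> by (simp add: ennreal_mult mult_ac)
  have split: "?T (insert b B) (x(b := y)) = (?T B x)(b := t b + c * y)" for x y
    using insert.hyps by (auto simp: fun_eq_iff)
  have meas_T: "(\<lambda>y. \<integral>\<^sup>+x. h ((?T B x)(b := y)) \<partial>?M B) \<in> borel_measurable lborel"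
  proof -
    interpret B: sigma_finite_measure "?M B"
      by (rule sigma_finite) fact
    have "(\<lambda>p. (?T B (snd p))(b := fst p)) \<in> measurable (lborel \<Otimes>\<^sub>M ?M B) (?M (insert b B))"
      by (rule measurable_fun_upd[where J = B])
         (auto intro: measurable_compose[OF measurable_snd T])
    from measurable_compose[OF this insert.prems] show ?thesis
      by (intro B.borel_measurable_nn_integral) (simp add: case_prod_beta')
  qed
  have "(\<integral>\<^sup>+y. h y \<partial>?M (insert b B)) = (\<integral>\<^sup>+y. (\<integral>\<^sup>+x. h (x(b := y)) \<partial>?M B) \<partial>lborel)"
    using insert by (intro product_nn_integral_insert_rev) auto
  also have "\<dots> = (\<integral>\<^sup>+y. ennreal (c ^ card B) * (\<integral>\<^sup>+x. h ((?T B x)(b := y)) \<partial>?M B) \<partial>lborel)"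
    by (simp only: insert.IH[OF meas_add])
  also have "\<dots> = ennreal (c ^ card B) * (\<integral>\<^sup>+y. (\<integral>\<^sup>+x. h ((?T B x)(b := y)) \<partial>?M B) \<partial>lborel)"
    by (rule nn_integral_cmult) (use meas_T in simp)
  also have "(\<integral>\<^sup>+y. (\<integral>\<^sup>+x. h ((?T B x)(b := y)) \<partial>?M B) \<partial>lborel) =
      ennreal c * (\<integral>\<^sup>+y. (\<integral>\<^sup>+x. h ((?T B x)(b := t b + c * y)) \<partial>?M B) \<partial>lborel)"
    using nn_integral_real_affine[OF meas_T[simplified], of c "t b"] \<open>c > 0\<close> by simp
  also have "(\<integral>\<^sup>+y. (\<integral>\<^sup>+x. h ((?T B x)(b := t b + c * y)) \<partial>?M B) \<partial>lborel) =
      (\<integral>\<^sup>+y. h (?T (insert b B) y) \<partial>?M (insert b B))"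
    unfolding split[symmetric]
    using insert.hyps T'
    by (intro product_nn_integral_insert_rev[symmetric] measurable_compose[OF T' insert.prems])
  finally show ?case
    unfolding pow .
qed

text \<open>By Fubini, it suffices to compare the sections of \<open>A\<close> and \<open>E\<close> in the \<open>B\<close>-coordinates. With
  the other coordinates fixed, the shift \<open>z f\<close> is constant, so the map from the section of \<open>A\<close> to
  that of \<open>E\<close> is a homothety.\<close>

lemma emeasure_PiM_lborel_le_by_shrinking:
  fixes z :: "('i \<Rightarrow> real) \<Rightarrow> 'i \<Rightarrow> real"
  assumes I: "finite I" "B \<subseteq> I" and c: "c > 0"
    and A: "A \<in> sets (\<Pi>\<^sub>M i\<in>I. lborel)" and E: "E \<in> sets (\<Pi>\<^sub>M i\<in>I. lborel)"
    and z: "\<And>f g i. (\<And>j. j \<notin> B \<Longrightarrow> f j = g j) \<Longrightarrow> i \<in> B \<Longrightarrow> z f i = z g i"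
    and AE: "\<And>f. f \<in> A \<Longrightarrow> (\<lambda>i. if i \<in> B then z f i + c * f i else f i) \<in> E"
  shows "emeasure (\<Pi>\<^sub>M i\<in>I. lborel) A
    \<le> ennreal ((1 / c) ^ card B) * emeasure (\<Pi>\<^sub>M i\<in>I. lborel) E"
proof -
  interpret product_sigma_finite "\<lambda>_::'i. lborel :: real measure" ..
  let ?M = "\<lambda>B. \<Pi>\<^sub>M i\<in>B. (lborel :: real measure)"
  let ?O = "I - B"
  have fin: "finite B" "finite ?O" and un: "?O \<union> B = I" and dis: "?O \<inter> B = {}"
    using I finite_subset by auto
  have fold: "emeasure (?M I) X =
      (\<integral>\<^sup>+x. (\<integral>\<^sup>+y. indicator X (merge ?O B (x, y)) \<partial>?M B) \<partial>?M ?O)"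
    if "X \<in> sets (?M I)" for X
  proof -
    have "emeasure (?M I) X = (\<integral>\<^sup>+f. indicator X f \<partial>?M (?O \<union> B))"
      using that un by simp
    also have "\<dots> = (\<integral>\<^sup>+x. (\<integral>\<^sup>+y. indicator X (merge ?O B (x, y)) \<partial>?M B) \<partial>?M ?O)"
      using fin dis that un by (intro product_nn_integral_fold) auto
    finally show ?thesis .
  qed
  have mono: "(\<integral>\<^sup>+y. indicator A (merge ?O B (x, y)) \<partial>?M B)
      \<le> ennreal ((1 / c) ^ card B) * (\<integral>\<^sup>+y. indicator E (merge ?O B (x, y)) \<partial>?M B)"
    if x: "x \<in> space (?M ?O)" for x
  proof -
    \<comment> \<open>The shift for the section over \<open>x\<close>; the values in \<open>B\<close> do not influence it.\<close>
    define w where "w = z (merge ?O B (x, \<lambda>_. undefined))"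
    have le: "indicator A (merge ?O B (x, y)) \<le>
        (indicator E (merge ?O B (x, \<lambda>i\<in>B. w i + c * y i)) :: ennreal)" for y
    proof (cases "merge ?O B (x, y) \<in> A")
      case True
      let ?f = "merge ?O B (x, y)"
      have "w i = z ?f i" if "i \<in> B" for i
        unfolding w_def using that by (intro z) (auto simp: merge_def)
      then have "merge ?O B (x, \<lambda>i\<in>B. w i + c * y i) =
          (\<lambda>i. if i \<in> B then z ?f i + c * ?f i else ?f i)"
        by (auto simp: merge_def fun_eq_iff)
      then show ?thesis using AE[OF True] by (simp add: indicator_def)
    qed simp
    have meas: "(\<lambda>y. indicator E (merge ?O B (x, y)) :: ennreal) \<in> borel_measurable (?M B)"
    proof -
      have "(\<lambda>y. merge ?O B (x, y)) \<in> measurable (?M B) (?M (?O \<union> B))"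
        using x by (intro measurable_compose[OF measurable_Pair1' measurable_merge])
      then show ?thesis
        using E un by (intro measurable_compose[OF _ borel_measurable_indicator]) auto
    qed
    have "(1 / c) ^ card B * c ^ card B = 1"
      using c by (simp add: power_one_over)
    then have cancel: "ennreal ((1 / c) ^ card B) * (ennreal (c ^ card B) * X) = X" for X
      using c by (simp add: mult.assoc[symmetric] ennreal_mult[symmetric] del: power_one_over)
    have "(\<integral>\<^sup>+y. indicator A (merge ?O B (x, y)) \<partial>?M B)
        \<le> (\<integral>\<^sup>+y. indicator E (merge ?O B (x, \<lambda>i\<in>B. w i + c * y i)) \<partial>?M B)"
      by (intro nn_integral_mono le)
    also have "\<dots> = ennreal ((1 / c) ^ card B) *
        (\<integral>\<^sup>+y. indicator E (merge ?O B (x, y)) \<partial>?M B)"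
      by (simp only: nn_integral_PiM_lborel_affine[OF fin(1) c meas, of w] cancel)
    finally show ?thesis .
  qed
  have meas2: "(\<lambda>x. \<integral>\<^sup>+y. indicator E (merge ?O B (x, y)) \<partial>?M B) \<in> borel_measurable (?M ?O)"
  proof -
    interpret B: sigma_finite_measure "?M B"
      by (rule sigma_finite) (use fin in auto)
    have "(\<lambda>p. indicator E (merge ?O B p) :: ennreal) \<in> borel_measurable (?M ?O \<Otimes>\<^sub>M ?M B)"
      using E un by (intro measurable_compose[OF measurable_merge borel_measurable_indicator]) auto
    then show ?thesis
      by (intro B.borel_measurable_nn_integral) (simp add: case_prod_beta')
  qed
  show ?thesis
    unfolding fold[OF A] fold[OF E] nn_integral_cmult[OF meas2, symmetric]
    by (intro nn_integral_mono mono)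
qed

section \<open>Pulling up a peak inside a block of layers\<close>

lemma mem_cyc_verts: "(u, i) \<in> cyc_verts n k \<longleftrightarrow> 1 \<le> u \<and> u \<le> n \<and> 1 \<le> i \<and> i \<le> k"
  by (auto simp: cyc_verts_def)

lemma cyc_edges_subset: "{u, w} \<in> cyc_edges n k \<Longrightarrow> u \<in> cyc_verts n k \<and> w \<in> cyc_verts n k"
  by (auto simp: cyc_edges_def doubleton_eq_iff)

lemma cyc_edges_Suc:
  assumes "(u, i) \<in> cyc_verts n k" "(Suc u, j) \<in> cyc_verts n k"
  shows "{(u, i), (Suc u, j)} \<in> cyc_edges n k"
proof -
  have "[int u - int (Suc u) = - 1] (mod int n)"
    by simp
  with assms show ?thesis
    unfolding cyc_edges_def by blast
qed

text \<open>Blocks of layers will be placed so that they touch neither layer 1 nor layer \<open>n\<close>; the cyclic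
  adjacency is then the linear one.\<close>

lemma cyc_edges_inner_layer:
  assumes "{(u, i), (w, j)} \<in> cyc_edges n k" "1 < u" "u < n"
  shows "w = Suc u \<or> u = Suc w"
proof -
  have rng: "1 \<le> w" "w \<le> n"
    using cyc_edges_subset[OF assms(1)] by (auto simp: mem_cyc_verts)
  have "[int u - int w = 1] (mod int n) \<or> [int u - int w = - 1] (mod int n)"
    using assms(1) by (auto simp: cyc_edges_def doubleton_eq_iff cong_iff_dvd_diff dvd_diff_commute
        algebra_simps)
  then have "int n dvd int u - int w - 1 \<or> int n dvd int u - int w + 1"
    by (simp add: cong_iff_dvd_diff)
  then show ?thesis
  proof
    assume "int n dvd int u - int w - 1"
    moreover have "\<bar>int u - int w - 1\<bar> < int n"
      using assms rng by auto
    ultimately show ?thesis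
      using dvd_imp_le_int[of "int u - int w - 1" "int n"] by (cases "int u - int w - 1 = 0") auto
  next
    assume "int n dvd int u - int w + 1"
    moreover have "\<bar>int u - int w + 1\<bar> < int n"
      using assms rng by auto
    ultimately show ?thesis
      using dvd_imp_le_int[of "int u - int w + 1" "int n"] by (cases "int u - int w + 1 = 0") auto
  qed
qed

text \<open>The vertices strictly between the layers \<open>a\<close> and \<open>a + 2 * D\<close>. The two bounding layers are left
  out, because the values there prescribe where a modification has to start and end.\<close>

definition block :: "nat \<Rightarrow> nat \<Rightarrow> nat \<Rightarrow> (nat \<times> nat) set" where
  "block k a D = {a<..<a + 2 * D} \<times> {1..k}"

definition layer_min :: "nat \<Rightarrow> nat \<Rightarrow> (nat \<times> nat \<Rightarrow> real) \<Rightarrow> real" where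
  "layer_min k u f = Min ((\<lambda>i. f (u, i)) ` {1..k})"

text \<open>The McShane extension from the two bounding layers: distances from a vertex of the block to
  them are differences of layer numbers, and the complete bipartite graphs between layers let only
  the smallest value of each bounding layer matter.\<close>

definition tent :: "nat \<Rightarrow> nat \<Rightarrow> nat \<Rightarrow> (nat \<times> nat \<Rightarrow> real) \<Rightarrow> nat \<times> nat \<Rightarrow> real" where
  "tent k a D f v = min (layer_min k a f + (real (fst v) - real a))
                        (layer_min k (a + 2 * D) f + (real (a + 2 * D) - real (fst v)))"

definition pull_up :: "nat \<Rightarrow> nat \<Rightarrow> nat \<Rightarrow> (nat \<times> nat \<Rightarrow> real) \<Rightarrow> nat \<times> nat \<Rightarrow> real" where
  "pull_up k a D f v =
     (if v \<in> block k a D then 3 / 4 * tent k a D f v + 1 / 4 * f v else f v)"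

lemma layer_min_le: "1 \<le> i \<Longrightarrow> i \<le> k \<Longrightarrow> layer_min k u f \<le> f (u, i)"
  by (auto simp: layer_min_def)

lemma layer_min_attained: "k > 0 \<Longrightarrow> \<exists>i\<in>{1..k}. layer_min k u f = f (u, i)"
  using Min_in[of "(\<lambda>i. f (u, i)) ` {1..k}"] by (fastforce simp: layer_min_def)

lemma tent_cong:
  assumes "\<And>v. v \<notin> block k a D \<Longrightarrow> f v = g v"
  shows "tent k a D f = tent k a D g"
proof -
  have "f (a, i) = g (a, i)" "f (a + 2 * D, i) = g (a + 2 * D, i)" for i
    using assms by (auto simp: block_def)
  then show ?thesis
    by (simp add: tent_def layer_min_def fun_eq_iff)
qed

lemma Lip_cyc_Suc:
  assumes "f \<in> Lip (cyc_verts n k) (cyc_edges n k) v0"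
    and "(u, i) \<in> cyc_verts n k" "(Suc u, j) \<in> cyc_verts n k"
  shows "\<bar>f (u, i) - f (Suc u, j)\<bar> \<le> 1"
  using assms(1) cyc_edges_Suc[OF assms(2,3)] by (auto simp: Lip_def)

text \<open>Any two vertices of a layer have a common neighbour.\<close>

lemma Lip_layer_spread:
  assumes f: "f \<in> Lip (cyc_verts n k) (cyc_edges n k) v0"
    and "(u, i) \<in> cyc_verts n k" "n \<ge> 2"
  shows "f (u, i) \<le> layer_min k u f + 2"
proof -
  have k: "k > 0" and u: "1 \<le> u" "u \<le> n"
    using assms by (auto simp: mem_cyc_verts)
  obtain i' where i': "i' \<in> {1..k}" "layer_min k u f = f (u, i')"
    using layer_min_attained[OF k] by blast
  show ?thesis
  proof (cases "u < n")
    case True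
    then have "\<bar>f (u, i) - f (Suc u, 1)\<bar> \<le> 1" "\<bar>f (u, i') - f (Suc u, 1)\<bar> \<le> 1"
      using assms i' k u by (auto intro!: Lip_cyc_Suc[OF f] simp: mem_cyc_verts)
    then show ?thesis using i' by linarith
  next
    case False
    define t where "t = u - 1"
    have t: "u = Suc t" "1 \<le> t" using False u \<open>n \<ge> 2\<close> by (auto simp: t_def)
    then have "\<bar>f (t, 1) - f (Suc t, i)\<bar> \<le> 1" "\<bar>f (t, 1) - f (Suc t, i')\<bar> \<le> 1"
      using assms i' k u by (auto intro!: Lip_cyc_Suc[OF f] simp: mem_cyc_verts)
    then show ?thesis using i' t by auto
  qed
qed

context
  fixes n k a D :: nat and v0 :: "nat \<times> nat" and f :: "nat \<times> nat \<Rightarrow> real"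
  assumes f: "f \<in> Lip (cyc_verts n k) (cyc_edges n k) v0"
    and k: "k > 0" and D: "D \<ge> 2" and a: "1 \<le> a" "a + 2 * D \<le> n"
    and osc: "\<And>u w. u \<in> cyc_verts n k \<Longrightarrow> w \<in> cyc_verts n k \<Longrightarrow> f u - f w < 3 / 4 * real D"
begin

lemma osc_layer_min:
  assumes "w \<in> cyc_verts n k"
  shows "f w - layer_min k a f < 3 / 4 * real D"
    and "f w - layer_min k (a + 2 * D) f < 3 / 4 * real D"
proof -
  obtain i j where "i \<in> {1..k}" "layer_min k a f = f (a, i)"
    and "j \<in> {1..k}" "layer_min k (a + 2 * D) f = f (a + 2 * D, j)"
    using layer_min_attained[OF k] by metis
  moreover from this have "(a, i) \<in> cyc_verts n k" "(a + 2 * D, j) \<in> cyc_verts n k"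
    using a by (auto simp: mem_cyc_verts)
  ultimately show "f w - layer_min k a f < 3 / 4 * real D"
    and "f w - layer_min k (a + 2 * D) f < 3 / 4 * real D"
    using osc[OF assms] by metis+
qed

text \<open>Inside the block the tent is a minimum of functions of slope 1. At the boundary, the upper bound
  for the tent is clear from its definition; for the lower bound, a boundary value exceeds the
  minimum of its own layer by at most 2, and that of the opposite layer by less than \<open>2 * D\<close>,
  as \<open>f\<close> is flat. Edges are unordered, so a one-sided inequality is enough.\<close>

lemma tent_glued_Lip:
  fixes u w :: "nat \<times> nat"
  assumes uw: "{u, w} \<in> cyc_edges n k"
  defines "Z \<equiv> \<lambda>v. if v \<in> block k a D then tent k a D f v else f v"
  shows "Z u \<le> Z w + 1"
proof -
  obtain x i y j where [simp]: "u = (x, i)" "w = (y, j)"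
    by (cases u; cases w)
  have V: "u \<in> cyc_verts n k" "w \<in> cyc_verts n k"
    using cyc_edges_subset[OF uw] by auto
  then have ij: "1 \<le> i" "i \<le> k" "1 \<le> j" "j \<le> k"
    by (auto simp: mem_cyc_verts)
  let ?p = "layer_min k a f" and ?q = "layer_min k (a + 2 * D) f"
  have wu: "{w, u} \<in> cyc_edges n k"
    using uw by (simp add: insert_commute)
  consider "u \<notin> block k a D" "w \<notin> block k a D" | "u \<in> block k a D" "w \<in> block k a D"
    | "u \<in> block k a D" "w \<notin> block k a D" | "u \<notin> block k a D" "w \<in> block k a D"
    by blast
  then show ?thesis
  proof cases
    case 1
    have "\<bar>f u - f w\<bar> \<le> 1"
      using f uw unfolding Lip_def by blast
    with 1 show ?thesis by (simp add: Z_def)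
  next
    case 2
    then have "y = Suc x \<or> x = Suc y"
      using cyc_edges_inner_layer[of x i y j n k] uw a by (auto simp: block_def)
    then show ?thesis
      using 2 by (auto simp: Z_def tent_def min_def)
  next
    case 3
    then have "y = Suc x \<or> x = Suc y"
      using cyc_edges_inner_layer[of x i y j n k] uw a by (auto simp: block_def)
    with 3 ij have "(y = a \<and> x = Suc a) \<or> (y = a + 2 * D \<and> Suc x = a + 2 * D)"
      by (auto simp: block_def)
    then show ?thesis
    proof
      assume *: "y = a \<and> x = Suc a"
      have "Z u \<le> ?p + 1" using 3 * by (simp add: Z_def tent_def)
      also have "?p \<le> f w" using * ij by (simp add: layer_min_le)
      finally show ?thesis using 3 by (simp add: Z_def)
    next
      assume *: "y = a + 2 * D \<and> Suc x = a + 2 * D"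
      then have "real (a + 2 * D) - real x = 1" by linarith
      then have "Z u \<le> ?q + 1" using 3 by (simp add: Z_def tent_def)
      also have "?q \<le> f w" using * ij by (simp add: layer_min_le)
      finally show ?thesis using 3 by (simp add: Z_def)
    qed
  next
    case 4
    then have "x = Suc y \<or> y = Suc x"
      using cyc_edges_inner_layer[of y j x i n k] wu a by (auto simp: block_def)
    with 4 ij have *: "(x = a \<and> y = Suc a) \<or> (x = a + 2 * D \<and> Suc y = a + 2 * D)"
      by (auto simp: block_def)
    have "f u \<le> ?p + 2" if "x = a"
      using Lip_layer_spread[OF f, of x i] V a D that by simp
    moreover have "f u \<le> ?q + 2" if "x = a + 2 * D"
      using Lip_layer_spread[OF f, of x i] V a D that by simp
    moreover have "f u \<le> ?p + 2 * D" "f u \<le> ?q + 2 * D"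
      using osc_layer_min[OF V(1)] D by linarith+
    moreover have "real (a + 2 * D) - real y = 1 \<and> real y - real a = 2 * D - 1"
      if "Suc y = a + 2 * D"
      using that D by linarith
    ultimately have "f u \<le> tent k a D f w + 1"
      using * by (auto simp: tent_def min_def)
    with 4 show ?thesis by (simp add: Z_def)
  qed
qed

lemma pull_up_Lip:
  assumes v0: "v0 \<in> cyc_verts n k" "v0 \<notin> block k a D"
  shows "pull_up k a D f \<in> Lip (cyc_verts n k) (cyc_edges n k) v0"
proof -
  let ?Z = "\<lambda>v. if v \<in> block k a D then tent k a D f v else f v"
  have eq: "pull_up k a D f v = 3 / 4 * ?Z v + 1 / 4 * f v" for v
    by (simp add: pull_up_def)
  have "\<bar>pull_up k a D f u - pull_up k a D f w\<bar> \<le> 1" if uw: "{u, w} \<in> cyc_edges n k" for u w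
  proof -
    have "{w, u} \<in> cyc_edges n k"
      using uw by (simp add: insert_commute)
    then have "?Z u \<le> ?Z w + 1" "?Z w \<le> ?Z u + 1"
      using tent_glued_Lip uw by blast+
    moreover have "\<bar>f u - f w\<bar> \<le> 1"
      using f uw unfolding Lip_def by blast
    ultimately show ?thesis
      unfolding eq by linarith
  qed
  moreover have "block k a D \<subseteq> cyc_verts n k"
    using a by (auto simp: block_def cyc_verts_def)
  then have "pull_up k a D f \<in> cyc_verts n k \<rightarrow>\<^sub>E UNIV"
    using f by (auto simp: Lip_def pull_up_def PiE_def extensional_def)
  moreover have "pull_up k a D f v0 = 0"
    using f v0 by (simp add: Lip_def pull_up_def)
  ultimately show ?thesis
    by (simp add: Lip_def)
qed

text \<open>In the middle of the block the tent is \<open>D\<close> above the smaller of two values of \<open>f\<close>, hence more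
  than \<open>D / 4\<close> above \<open>f w\<close>, while \<open>f\<close> itself is less than \<open>3 / 4 * D\<close> below \<open>f w\<close> there. The
  weights \<open>3 / 4\<close> and \<open>1 / 4\<close> make these two effects cancel exactly.\<close>

lemma pull_up_peak:
  assumes w: "w \<in> cyc_verts n k" "w \<notin> block k a D"
  shows "pull_up k a D f w < pull_up k a D f (a + D, 1)"
proof -
  let ?v = "(a + D, 1) :: nat \<times> nat"
  have v: "?v \<in> block k a D" "?v \<in> cyc_verts n k"
    using k D a by (auto simp: block_def mem_cyc_verts)
  have "f w - f ?v < 3 / 4 * real D"
    using osc w(1) v(2) by blast
  moreover have "tent k a D f ?v > f w - 3 / 4 * real D + real D"
    using osc_layer_min[OF w(1)] by (auto simp: tent_def)
  ultimately show ?thesis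
    using v w by (simp add: pull_up_def)
qed

end

section \<open>From volumes to probabilities\<close>

lemma measurable_pinned_component:
  assumes "v \<in> V"
  shows "(\<lambda>g. (g(v0 := 0 :: real)) v) \<in> borel_measurable (\<Pi>\<^sub>M v\<in>V - {v0}. lborel)"
proof (cases "v = v0")
  case False
  then have "(\<lambda>g. g v) \<in> measurable (\<Pi>\<^sub>M v\<in>V - {v0}. lborel) lborel"
    using assms by (intro measurable_component_singleton) auto
  with False show ?thesis by simp
qed simp

lemma sets_pinned_Lip:
  assumes "finite V" "v0 \<in> V" "\<And>u w. {u, w} \<in> E \<Longrightarrow> u \<in> V \<and> w \<in> V"
  shows "{g \<in> space (\<Pi>\<^sub>M v\<in>V - {v0}. lborel). g(v0 := 0) \<in> Lip V E v0}
    \<in> sets (\<Pi>\<^sub>M v\<in>V - {v0}. (lborel :: real measure))"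
proof -
  let ?L = "\<Pi>\<^sub>M v\<in>V - {v0}. (lborel :: real measure)"
  note [measurable] = measurable_pinned_component
  have "{g \<in> space ?L. g(v0 := 0) \<in> Lip V E v0} =
      {g \<in> space ?L. \<forall>u\<in>V. \<forall>w\<in>V. {u, w} \<in> E \<longrightarrow> \<bar>(g(v0 := 0)) u - (g(v0 := 0)) w\<bar> \<le> 1}"
    using assms(2,3) by (auto simp: Lip_def space_PiM PiE_def extensional_def)
  also have "\<dots> \<in> sets ?L"
    using assms(1) by measurable
  finally show ?thesis .
qed

text \<open>Bounding a probability reduces to comparing volumes, also in the degenerate cases: if the volume
  of the Lipschitz functions is 0 or infinite, the quotient that defines the normalized measure is
  0 on \<open>X\<close>, and \<^const>\<open>measure\<close> is 0 on a set that is not measurable.\<close>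

lemma measure_Lip_unif_le:
  fixes V :: "'a set" and E v0
  defines "L \<equiv> \<Pi>\<^sub>M v\<in>V - {v0}. (lborel :: real measure)"
  defines "S \<equiv> {g \<in> space L. g(v0 := 0) \<in> Lip V E v0}"
  assumes V: "finite V" "v0 \<in> V" "\<And>u w. {u, w} \<in> E \<Longrightarrow> u \<in> V \<and> w \<in> V"
    and b: "b \<ge> 0"
    and bound: "emeasure L {g \<in> S. g(v0 := 0) \<in> X} \<le> ennreal b * emeasure L S"
  shows "measure (Lip_unif V E v0) X \<le> b"
proof (cases "X \<in> sets (\<Pi>\<^sub>M v\<in>V. (borel :: real measure))")
  case False
  then have "measure (Lip_unif V E v0) X = 0"
    by (intro measure_notin_sets) (simp add: Lip_unif_def Let_def)
  with b show ?thesis by simp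
next
  case True
  have S: "S \<in> sets L"
    unfolding S_def L_def by (rule sets_pinned_Lip) (use V in auto)
  have emb: "(\<lambda>g. g(v0 := 0)) \<in> measurable L (\<Pi>\<^sub>M v\<in>V. (borel :: real measure))"
    unfolding L_def
  proof (rule measurable_PiM_single')
    show "(\<lambda>g. g(v0 := 0)) \<in> space (\<Pi>\<^sub>M v\<in>V - {v0}. lborel) \<rightarrow> (\<Pi>\<^sub>E v\<in>V. space (borel :: real measure))"
      using V(2) by (auto simp: space_PiM PiE_def extensional_def)
  qed (rule measurable_pinned_component)
  then have emb': "(\<lambda>g. g(v0 := 0)) \<in> measurable (uniform_measure L S) (\<Pi>\<^sub>M v\<in>V. (borel :: real measure))"
    by (simp add: measurable_def)
  let ?Y = "(\<lambda>g. g(v0 := 0)) -` X \<inter> space L"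
  have "?Y \<in> sets L"
    using measurable_sets[OF emb True] .
  then have "emeasure (Lip_unif V E v0) X = emeasure L (S \<inter> ?Y) / emeasure L S"
    unfolding Lip_unif_def Let_def
    using emeasure_distr[OF emb' True] emeasure_uniform_measure[OF S]
    by (simp add: L_def S_def)
  also have "S \<inter> ?Y = {g \<in> S. g(v0 := 0) \<in> X}"
    by (auto simp: S_def)
  also have "emeasure L \<dots> / emeasure L S \<le> ennreal b"
  proof (cases "emeasure L S = 0")
    case True
    with bound show ?thesis by simp
  next
    case False
    with bound show ?thesis
      by (intro divide_le_posI_ennreal) (auto simp: mult.commute zero_less_iff_neq_zero)
  qed
  finally show ?thesis
    unfolding measure_def by (intro enn2real_leI b)
qed

lemma measure_Lip_unif_le_1:
  assumes "finite V" "v0 \<in> V" "\<And>u w. {u, w} \<in> E \<Longrightarrow> u \<in> V \<and> w \<in> V"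
  shows "measure (Lip_unif V E v0) X \<le> 1"
  using sets_pinned_Lip[OF assms]
  by (intro measure_Lip_unif_le assms) (auto intro!: emeasure_mono)

section \<open>Flat functions are rare\<close>

lemma finite_cyc_verts: "finite (cyc_verts n k)"
  by (simp add: cyc_verts_def)

context
  fixes n k D :: nat and v0 :: "nat \<times> nat"
  assumes k: "k > 0" and D: "D \<ge> 2" and v0: "v0 \<in> cyc_verts n k"
begin

abbreviation (input) "V \<equiv> cyc_verts n k"
abbreviation (input) "vol \<equiv> \<Pi>\<^sub>M v\<in>V - {v0}. (lborel :: real measure)"

definition "lips = {g \<in> space vol. g(v0 := 0) \<in> Lip V (cyc_edges n k) v0}"
definition "flat_lips = {g \<in> lips. \<forall>u\<in>V. \<forall>w\<in>V. (g(v0 := 0)) u - (g(v0 := 0)) w < 3 / 4 * real D}"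
definition "peaked_lips B = {g \<in> lips. \<exists>v\<in>B. \<forall>w\<in>V - B. (g(v0 := 0)) w < (g(v0 := 0)) v}"

lemma sets_lips: "lips \<in> sets vol"
  unfolding lips_def
  by (rule sets_pinned_Lip) (use v0 cyc_edges_subset in \<open>auto simp: finite_cyc_verts\<close>)

lemma sets_flat_lips: "flat_lips \<in> sets vol"
proof -
  note [measurable] = measurable_pinned_component sets_lips
  have "{g \<in> space vol. g \<in> lips \<and>
      (\<forall>u\<in>V. \<forall>w\<in>V. (g(v0 := 0)) u - (g(v0 := 0)) w < 3 / 4 * real D)} \<in> sets vol"
    using finite_cyc_verts by measurable
  also have "{g \<in> space vol. g \<in> lips \<and>
      (\<forall>u\<in>V. \<forall>w\<in>V. (g(v0 := 0)) u - (g(v0 := 0)) w < 3 / 4 * real D)} = flat_lips"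
    by (auto simp: flat_lips_def lips_def)
  finally show ?thesis .
qed

lemma sets_peaked_lips:
  assumes "B \<subseteq> V"
  shows "peaked_lips B \<in> sets vol"
proof -
  note [measurable] = measurable_pinned_component sets_lips
  have fin: "finite B" "finite (V - B)"
    using finite_subset[OF assms] finite_cyc_verts by auto
  have mem: "v \<in> B \<Longrightarrow> v \<in> V" "w \<in> V - B \<Longrightarrow> w \<in> V" for v w
    using assms by auto
  have "{g \<in> space vol. g \<in> lips \<and>
      (\<exists>v\<in>B. \<forall>w\<in>V - B. (g(v0 := 0)) w < (g(v0 := 0)) v)} \<in> sets vol"
    using fin mem by measurable
  also have "{g \<in> space vol. g \<in> lips \<and>
      (\<exists>v\<in>B. \<forall>w\<in>V - B. (g(v0 := 0)) w < (g(v0 := 0)) v)} = peaked_lips B"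
    by (auto simp: peaked_lips_def lips_def)
  finally show ?thesis .
qed

text \<open>A peak in \<open>B\<close> lies off \<open>B'\<close> and conversely, so each of two such peaks would be higher than
  the other.\<close>

lemma peaked_lips_disjoint:
  assumes "B \<subseteq> V" "B' \<subseteq> V" "B \<inter> B' = {}"
  shows "peaked_lips B \<inter> peaked_lips B' = {}"
proof (rule equals0I)
  fix g assume "g \<in> peaked_lips B \<inter> peaked_lips B'"
  then obtain v v' where "v \<in> B" "\<And>w. w \<in> V - B \<Longrightarrow> (g(v0 := 0)) w < (g(v0 := 0)) v"
    and "v' \<in> B'" "\<And>w. w \<in> V - B' \<Longrightarrow> (g(v0 := 0)) w < (g(v0 := 0)) v'"
    unfolding peaked_lips_def by blast
  moreover from this assms have "v \<in> V - B'" "v' \<in> V - B"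
    by auto
  ultimately show False
    using less_asym by blast
qed

lemma emeasure_flat_le_peaked:
  assumes a: "1 \<le> a" "a + 2 * D \<le> n" and v0_out: "v0 \<notin> block k a D"
  shows "emeasure vol flat_lips
    \<le> ennreal (4 ^ (k * (2 * D - 1))) * emeasure vol (peaked_lips (block k a D))"
proof -
  let ?B = "block k a D"
  have BV: "?B \<subseteq> V"
    using a by (auto simp: block_def cyc_verts_def)
  have card: "card ?B = k * (2 * D - 1)"
    by (simp add: block_def card_cartesian_product)
  define z where "z f v = 3 / 4 * tent k a D (f(v0 := 0)) v" for f v
  have "emeasure vol flat_lips
    \<le> ennreal ((1 / (1 / 4)) ^ card ?B) * emeasure vol (peaked_lips ?B)"
  proof (rule emeasure_PiM_lborel_le_by_shrinking[where z = z])
    show "finite (V - {v0})" "?B \<subseteq> V - {v0}"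
      using BV v0_out finite_cyc_verts by auto
    show "flat_lips \<in> sets vol" "peaked_lips ?B \<in> sets vol"
      using sets_flat_lips sets_peaked_lips[OF BV] by auto
    show "z f i = z g i" if "\<And>j. j \<notin> ?B \<Longrightarrow> f j = g j" for f g i
    proof -
      have "tent k a D (f(v0 := 0)) = tent k a D (g(v0 := 0))"
        by (rule tent_cong) (use that in auto)
      then show ?thesis by (simp add: z_def)
    qed
    fix g assume g: "g \<in> flat_lips"
    let ?f = "g(v0 := 0)"
    let ?h = "\<lambda>i. if i \<in> ?B then z g i + 1 / 4 * g i else g i"
    have f: "?f \<in> Lip V (cyc_edges n k) v0"
      and osc: "\<And>u w. u \<in> V \<Longrightarrow> w \<in> V \<Longrightarrow> ?f u - ?f w < 3 / 4 * real D"
      and sp: "g \<in> space vol"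
      using g by (auto simp: flat_lips_def lips_def)
    have h: "?h(v0 := 0) = pull_up k a D ?f"
      using v0_out by (auto simp: pull_up_def z_def fun_eq_iff)
    have "?h \<in> space vol"
      using sp BV v0_out by (auto simp: space_PiM PiE_def extensional_def)
    moreover have "pull_up k a D ?f \<in> Lip V (cyc_edges n k) v0"
      by (rule pull_up_Lip[OF f k D a osc v0 v0_out])
    moreover have "(a + D, 1) \<in> ?B"
      using k D by (auto simp: block_def)
    moreover have "\<forall>w\<in>V - ?B. pull_up k a D ?f w < pull_up k a D ?f (a + D, 1)"
      using pull_up_peak[OF f k D a osc] by blast
    ultimately show "?h \<in> peaked_lips ?B"
      unfolding peaked_lips_def lips_def mem_Collect_eq h by blast
  qed simp
  then show ?thesis
    by (simp add: card)
qed

text \<open>Consecutive blocks, placed with period \<open>2 * D\<close> from layer 1 on, have a bounding layer in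
  common but are disjoint. The number of those that fit into \<open>n\<close> layers is \<open>(n - 1) div (2 * D)\<close>; one of them may contain \<open>v0\<close> and
  is lost.\<close>

lemma card_blocks_emeasure_flat_le:
  "of_nat ((n - 1) div (2 * D) - 1) * emeasure vol flat_lips
    \<le> ennreal (4 ^ (k * (2 * D - 1))) * emeasure vol lips"
proof -
  let ?J = "(n - 1) div (2 * D)"
  let ?a = "\<lambda>j. 2 * D * j + 1"
  let ?B = "\<lambda>j. block k (?a j) D"
  define T where "T = {j \<in> {..<?J}. v0 \<notin> ?B j}"
  \<comment> \<open>The layer of a vertex determines its block; this gives both disjointness and the fact that
    at most one block contains \<open>v0\<close>.\<close>
  have layer: "j = (fst v - 1) div (2 * D)" if "v \<in> ?B j" for v j
  proof -
    have "2 * D * j \<le> fst v - 1" "fst v - 1 < 2 * D * Suc j"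
      using that by (auto simp: block_def)
    then show ?thesis
      by (metis div_nat_eqI mult.commute)
  qed
  have disj: "?B i \<inter> ?B j = {}" if "i \<noteq> j" for i j
    using layer that by blast
  have fit: "?a j + 2 * D \<le> n" if "j < ?J" for j
  proof -
    have "2 * D * Suc j \<le> 2 * D * ?J"
      using that by (intro mult_le_mono2) simp
    also have "\<dots> \<le> n - 1"
      by (rule times_div_less_eq_dividend)
    finally show ?thesis
      using v0 by (cases v0) (auto simp: mem_cyc_verts)
  qed
  have sub: "?B j \<subseteq> V" if "j \<in> T" for j
    using fit[of j] that by (auto simp: T_def block_def cyc_verts_def)
  have fin: "finite T" by (simp add: T_def)
  have "{..<?J} - {(fst v0 - 1) div (2 * D)} \<subseteq> T"
    using layer[of v0] by (fastforce simp: T_def)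
  then have "card ({..<?J} - {(fst v0 - 1) div (2 * D)}) \<le> card T"
    using fin by (rule card_mono[rotated])
  then have cardT: "?J - 1 \<le> card T"
    using diff_card_le_card_Diff[of "{(fst v0 - 1) div (2 * D)}" "{..<?J}"] by simp
  have "of_nat (?J - 1) * emeasure vol flat_lips \<le> (\<Sum>j\<in>T. emeasure vol flat_lips)"
    using cardT by (auto intro: mult_right_mono)
  also have "\<dots> \<le> (\<Sum>j\<in>T. ennreal (4 ^ (k * (2 * D - 1))) * emeasure vol (peaked_lips (?B j)))"
    by (rule sum_mono, rule emeasure_flat_le_peaked) (use fit in \<open>auto simp: T_def\<close>)
  also have "\<dots> = ennreal (4 ^ (k * (2 * D - 1))) * (\<Sum>j\<in>T. emeasure vol (peaked_lips (?B j)))"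
    by (simp add: sum_distrib_left)
  also have "(\<Sum>j\<in>T. emeasure vol (peaked_lips (?B j))) = emeasure vol (\<Union>j\<in>T. peaked_lips (?B j))"
  proof (rule sum_emeasure)
    show "disjoint_family_on (\<lambda>j. peaked_lips (?B j)) T"
      unfolding disjoint_family_on_def
      by (intro ballI impI peaked_lips_disjoint sub disj)
    show "(\<lambda>j. peaked_lips (?B j)) ` T \<subseteq> sets vol"
      by (intro image_subsetI sets_peaked_lips sub)
  qed (rule fin)
  also have "\<dots> \<le> emeasure vol lips"
    by (rule emeasure_mono[OF _ sets_lips]) (auto simp: peaked_lips_def)
  finally show ?thesis
    by (simp add: mult_left_mono)
qed

lemma prob_flat_le:
  assumes X: "\<And>f u w. f \<in> X \<Longrightarrow> u \<in> V \<Longrightarrow> w \<in> V \<Longrightarrow> f u - f w < 3 / 4 * real D"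
    and J: "(n - 1) div (2 * D) > 1"
  shows "measure (Lip_unif V (cyc_edges n k) v0) X
    \<le> 4 ^ (k * (2 * D - 1)) / real ((n - 1) div (2 * D) - 1)"
proof (rule measure_Lip_unif_le)
  let ?m = "real ((n - 1) div (2 * D) - 1)" and ?c = "4 ^ (k * (2 * D - 1)) :: real"
  have m: "?m > 0" using J by simp
  have "emeasure vol {g \<in> lips. g(v0 := 0) \<in> X} \<le> emeasure vol flat_lips"
  proof (rule emeasure_mono[OF _ sets_flat_lips], rule subsetI)
    fix g assume "g \<in> {g \<in> lips. g(v0 := 0) \<in> X}"
    then show "g \<in> flat_lips"
      using X[of "g(v0 := 0)"] unfolding flat_lips_def by blast
  qed
  also have "\<dots> = ennreal (1 / ?m) * (ennreal ?m * emeasure vol flat_lips)"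
    using m by (simp add: mult.assoc[symmetric] ennreal_mult[symmetric])
  also have "ennreal ?m * emeasure vol flat_lips \<le> ennreal ?c * emeasure vol lips"
    using card_blocks_emeasure_flat_le by (simp only: ennreal_of_nat_eq_real_of_nat)
  also have "ennreal (1 / ?m) * (ennreal ?c * emeasure vol lips) = ennreal (?c / ?m) * emeasure vol lips"
    using m by (simp add: mult.assoc[symmetric] ennreal_mult[symmetric])
  finally show "emeasure vol {g \<in> {g \<in> space vol. g(v0 := 0) \<in> Lip V (cyc_edges n k) v0}. g(v0 := 0) \<in> X}
      \<le> ennreal (?c / ?m) * emeasure vol {g \<in> space vol. g(v0 := 0) \<in> Lip V (cyc_edges n k) v0}"
    by (simp add: lips_def mult_left_mono)
qed (use v0 cyc_edges_subset finite_cyc_verts in auto)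

end

text \<open>A lower bound, independent of \<open>k\<close> and \<open>D\<close>, for the number of blocks that avoid \<open>v0\<close> when
  \<open>D \<le> log 2 n\<close>.\<close>

definition block_supply :: "nat \<Rightarrow> real" where
  "block_supply n = (real n - 1) / (2 * log 2 (real n)) - 2"

text \<open>The constant \<open>1 / 24\<close> leaves room for rounding: with \<open>D = \<lceil>\<gamma> / 12\<rceil>\<close>, the bound \<open>\<gamma> > 24\<close> gives
  \<open>D \<le> \<gamma> / 8\<close>, so \<open>k * D \<le> log 2 n / 8\<close> and the volume factor is at most
  \<open>4 powr (log 2 n / 4) = sqrt n\<close>.\<close>

lemma prob_small_range_le:
  assumes n: "n \<ge> 4" and k: "k > 0" and v0: "v0 \<in> cyc_verts n k"
    and k\<gamma>: "real k * \<gamma> \<le> log 2 (real n)" and \<gamma>: "\<gamma> > 24" and pos: "block_supply n > 0"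
  shows "measure (Lip_unif (cyc_verts n k) (cyc_edges n k) v0)
      {f \<in> Lip (cyc_verts n k) (cyc_edges n k) v0. Lip_range (cyc_verts n k) f < 1 / 24 * \<gamma>}
    \<le> sqrt (real n) / block_supply n"
    (is "measure ?P ?X \<le> _")
proof -
  let ?l = "log 2 (real n)"
  define D where "D = nat \<lceil>\<gamma> / 12\<rceil>"
  have D: "\<gamma> / 12 \<le> real D" "real D \<le> \<gamma> / 8" "D \<ge> 2"
    using \<gamma> unfolding D_def by linarith+
  have kD: "real k * real D \<le> ?l / 8"
    using mult_left_mono[OF D(2), of "real k"] k\<gamma> by simp
  have "1 * real D \<le> real k * real D"
    using k by (intro mult_right_mono) auto
  with kD have Dl: "real D \<le> ?l / 8" by linarith
  then have l: "?l > 0" using D by linarith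
  have pow: "4 ^ (k * (2 * D - 1)) \<le> sqrt (real n)"
  proof -
    have "(4::real) ^ (k * (2 * D - 1)) \<le> 4 ^ (k * (2 * D))"
      by (intro power_increasing) auto
    also have "\<dots> = ((2::real) ^ 2) ^ (k * (2 * D))"
      by simp
    also have "\<dots> = 2 ^ (4 * (k * D))"
      by (simp only: power_mult[symmetric]) (simp add: mult_ac)
    also have "\<dots> = 2 powr real (4 * (k * D))"
      by (rule powr_realpow[symmetric]) simp
    also have "\<dots> \<le> 2 powr (?l / 2)"
      using kD by (intro powr_mono) auto
    also have "\<dots> = (2 powr ?l) powr (1 / 2)"
      by (simp add: powr_powr)
    also have "\<dots> = sqrt (real n)"
      using n by (simp add: powr_half_sqrt)
    finally show ?thesis .
  qed
  let ?J = "(n - 1) div (2 * D)"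
  have "real (n - 1) / real (2 * D) \<le> real ?J + 1"
    using real_of_int_div3[of "int (n - 1)" "int (2 * D)"]
    by (simp only: of_int_of_nat_eq zdiv_int[symmetric])
  moreover have "(real n - 1) / (2 * ?l) \<le> real (n - 1) / real (2 * D)"
    using n D Dl l by (auto simp: of_nat_diff intro!: divide_left_mono mult_pos_pos)
  ultimately have "block_supply n + 1 \<le> real ?J"
    by (simp add: block_supply_def)
  then have J: "?J > 1" "block_supply n \<le> real (?J - 1)"
    using pos by (auto simp: of_nat_diff)
  have "f u - f w < 3 / 4 * real D"
    if f: "f \<in> ?X" and "u \<in> cyc_verts n k" "w \<in> cyc_verts n k" for f u w
  proof -
    let ?I = "f ` cyc_verts n k"
    have "f u \<le> Max ?I" "Min ?I \<le> f w"
      using that finite_cyc_verts by (auto intro!: Max_ge Min_le)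
    moreover have "Max ?I - Min ?I + 1 < 1 / 24 * \<gamma>"
      using f by (simp add: Lip_range_def)
    ultimately show ?thesis using D(1) by linarith
  qed
  then have "measure ?P ?X \<le> 4 ^ (k * (2 * D - 1)) / real (?J - 1)"
    using prob_flat_le[OF k D(3) v0] J(1) by blast
  also have "\<dots> \<le> sqrt (real n) / block_supply n"
    using pow J(2) pos by (intro frac_le) auto
  finally show ?thesis .
qed

theorem corollary1p10:
  "\<exists>(C::real) (\<delta>::nat \<Rightarrow> real). C > 0 \<and> (\<forall>n. \<delta> n \<ge> 0) \<and> \<delta> \<longlonglongrightarrow> 0 \<and>
     (\<forall>(n::nat) (k::nat) (\<gamma>::real) v0.
        n \<ge> 4 \<longrightarrow> even n \<longrightarrow> k > 0 \<longrightarrow> \<gamma> > 0 \<longrightarrow> v0 \<in> cyc_verts n k \<longrightarrow>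
        real k \<le> log 2 (real n) / \<gamma> \<longrightarrow>
        measure (Lip_unif (cyc_verts n k) (cyc_edges n k) v0)
          {f \<in> Lip (cyc_verts n k) (cyc_edges n k) v0.
             Lip_range (cyc_verts n k) f < C * \<gamma>} \<le> \<delta> n)"
proof -
  define \<delta> where
    "\<delta> n = (if block_supply n > 0 then sqrt (real n) / block_supply n else 1)" for n
  have nonneg: "\<delta> n \<ge> 0" for n
    by (simp add: \<delta>_def)
  have "eventually (\<lambda>n. block_supply n > 0) sequentially"
    unfolding block_supply_def by real_asymp
  then have "eventually (\<lambda>n. sqrt (real n) / block_supply n = \<delta> n) sequentially"
    by eventually_elim (simp add: \<delta>_def)
  moreover have "(\<lambda>n. sqrt (real n) / block_supply n) \<longlonglongrightarrow> 0"
    unfolding block_supply_def by real_asymp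
  ultimately have lim: "\<delta> \<longlonglongrightarrow> 0"
    by (rule Lim_transform_eventually[rotated])
  have "measure (Lip_unif (cyc_verts n k) (cyc_edges n k) v0)
      {f \<in> Lip (cyc_verts n k) (cyc_edges n k) v0. Lip_range (cyc_verts n k) f < 1 / 24 * \<gamma>} \<le> \<delta> n"
    if n: "n \<ge> 4" and k: "k > 0" and \<gamma>: "\<gamma> > 0" and v0: "v0 \<in> cyc_verts n k"
      and le: "real k \<le> log 2 (real n) / \<gamma>" for n k \<gamma> v0
  proof (cases "\<gamma> > 24 \<and> block_supply n > 0")
    case True
    then show ?thesis
      using prob_small_range_le[OF n k v0, of \<gamma>] le \<gamma> by (simp add: \<delta>_def field_simps)
  next
    case False
    show ?thesis
    \<comment> \<open>Either \<open>\<gamma>\<close> is at most 24, and the event is empty because every range is at least 1, or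
      \<open>n\<close> is one of the finitely many values for which the trivial bound 1 is used.\<close>
    proof (cases "block_supply n > 0")
      case True
      have "Lip_range (cyc_verts n k) f \<ge> 1" for f
      proof -
        have "Min (f ` cyc_verts n k) \<le> f v0" "f v0 \<le> Max (f ` cyc_verts n k)"
          using v0 finite_cyc_verts by (auto intro!: Max_ge Min_le)
        then show ?thesis by (simp add: Lip_range_def)
      qed
      moreover have "1 / 24 * \<gamma> \<le> 1"
        using False True by simp
      ultimately have "{f \<in> Lip (cyc_verts n k) (cyc_edges n k) v0.
          Lip_range (cyc_verts n k) f < 1 / 24 * \<gamma>} = {}"
        by (force simp: not_less intro: order_trans)
      then show ?thesis
        by (simp only: measure_empty nonneg)
    next
      case False
      then show ?thesis
        using measure_Lip_unif_le_1[OF finite_cyc_verts v0 cyc_edges_subset]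
        by (simp add: \<delta>_def)
    qed
  qed
  then show ?thesis
    using nonneg lim by (intro exI[of _ "1 / 24"] exI[of _ \<delta>]) auto
qed

end
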